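(* Let $\mathrm{LP}_l(A,B)$ be a canonical lifted-product code with the two canonical logical-basis families $\{\bar Z_{i,j,m}\}$ and $\{\bar X_{i,j,m}\}$, $i\in[r_A]$, $j\in[r_B^*]$, $m\in[l]$. Then: (i) (Conjugate pairs) The supports of $\bar Z_{i,j,m}$ and $\bar X_{i',j',m'}$ intersect if and only if $i=i'$, $j=j'$ and $m=m'$. In that case, their supports intersect on exactly one physical qubit $q_L(i,j,m)$, the $m$-th physical qubit of the $(i,j)$-th physical fibre of the left block. Thus $[\bar Z_{i,j,m},\bar X_{i',j',m'}]=2\,\bar Z_{i,j,m}\bar X_{i',j',m'}\,\delta_{i,i'}\delta_{j,j'}\delta_{m,m'}$. (ii) (Cyclic symmetry) The $l$ $Z$-type (resp. $X$-type) logical operators sharing the same $(i,j)$ index are equivalent up to cyclic shifts: the physical cyclic shift $\sigma_t$ induced by multiplication by $x^t$ on $\mathcal M_1$ maps $\mathrm{supp}\,\bar Z_{i,j,m}\mapsto\mathrm{supp}\,\bar Z_{i,j,(m+t)\bmod l}$ and $\mathrm{supp}\,\bar X_{i,j,m}\mapsto\mathrm{supp}\,\bar X_{i,j,(m+t)\bmod l}$. (iii) (Row/column parallel structure) For any permutation $\sigma_C$ of the column indices $[r_B^*]$ and any permutation $\sigma_R$ of the row indices $[r_A]$, there exist corresponding physical permutations $P_C$, acting by $q_L(i,j,m)\mapsto q_L(i,\sigma_C(j),m)$, and $P_R$, acting by $q_L(i,j,m)\mapsto q_L(\sigma_R(i),j,m)$, such that $\mathrm{supp}\,\bar Z_{i,\sigma_C(j),m}=P_C(\mathrm{supp}\,\bar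 Z_{i,j,m})$ and $\mathrm{supp}\,\bar X_{\sigma_R(i),j,m}=P_R(\mathrm{supp}\,\bar X_{i,j,m})$. (iv) ($ZX$-duality) When the code is symmetric, i.e. $B=A^*$, the $Z$- and $X$-type logical operators also take the same form. Concretely, there exists a physical permutation $\tau$, in the form of an involution, such that $\mathrm{supp}\,\bar X_{i,j,m}=\tau(\mathrm{supp}\,\bar Z_{j,i,m})$ for all $i,j,m$. Its action on the physical supports of the canonical logical basis operators is $\tau:\mathrm{supp}\,\bar Z_{i,j,m}\mapsto\mathrm{supp}\,\bar X_{j,i,m}$.
   Context: $R=\mathbb F_2[x]/(x^l+1)$, $[n]=\{0,\dots,n-1\}$; $\bar f(x)=f(x^{-1})$ on $R$ and $A^*=\bar A^T$. For $A\in R^{m_A\times n_A}$, $B\in R^{m_B\times n_B}$, put $\mathcal A_1=R^{n_A}$, $\mathcal A_0=R^{m_A}$, $\mathcal B_1=R^{n_B}$, $\mathcal B_0=R^{m_B}$. $\mathrm{LP}_l(A,B)$ is the CSS code whose physical qubits are indexed by the binarization (coefficient vectors) of $\mathcal M_1=(\mathcal A_1\otimes_R\mathcal B_0)\oplus(\mathcal A_0\otimes_R\mathcal B_1)$, with $X$-checks given by $\partial_1=(A\otimes I,I\otimes B)$ and $Z$-checks by $\partial_2^*$, $\partial_2=\binom{I\otimes B}{A\otimes I}$. The left block $\mathcal A_1\otimes_R\mathcal B_0\cong R^{n_A\times m_B}$ has qubits $q_L(i,j,m)$ (coefficient of $x^m$ at entry $(i,j)$; the $l$ qubits with fixed $(i,j)$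 form the $(i,j)$-th physical fibre), and the right block $\mathcal A_0\otimes_R\mathcal B_1\cong R^{m_A\times n_B}$ has qubits $q_R(i,j,m)$. The shift $\sigma_t$ is $q_{L/R}(i,j,m)\mapsto q_{L/R}(i,j,(m+t)\bmod l)$. Canonical code and basis: let $r_A=n_A-m_A$, $r_B^*=m_B-n_B$. The code is canonical if, up to permuting coordinates of $\mathcal A_1$ and $\mathcal B_0$ (assumed done), there are $G_A^0\in R^{r_A\times m_A}$, $G_B^{*0}\in R^{r_B^*\times n_B}$ such that, with $u^{(i)}$, $e^{(i)}_{\mathcal A_1}$ the $i$-th rows of $(I_{r_A},G_A^0)$, $(I_{r_A},0)$ and $e^{(j)}_{\mathcal B_0}$, $v^{(j)}$ the $j$-th rows of $(I_{r_B^*},0)$, $(I_{r_B^*},G_B^{*0})$, the vectors $$\mathrm{supp}\,\bar Z_{i,j,m}=x^m u^{(i)}\otimes_R e^{(j)}_{\mathcal B_0},\qquad \mathrm{supp}\,\bar X_{i,j,m}=x^m e^{(i)}_{\mathcal A_1}\otimes_R v^{(j)}$$ (in the left block) are supports of members of a $Z$-type and an $X$-type logical basis of the code. $\bar Z_{i,j,m}$ (resp. $\bar X_{i,j,m}$) is the product of Pauli $Z$ (resp. $X$) over its support; these operators form the canonical logical basis. *)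

theory Defs
  imports Complex_Main "HOL-Library.Z2" "HOL-Library.Cardinality" "HOL-Computational_Algebra.Polynomial"
    "HOL-Combinatorics.Permutations" "Jordan_Normal_Form.Matrix"
begin

section \<open>The ring of binary circulants\<close>

text \<open>
  The lift size l is the cardinality of the (arbitrary, finite) type \<open>'l\<close>, so that
  \<open>'l circ\<close> is the quotient ring of polynomials over GF(2) by the ideal generated by
  \<open>x ^ l + 1\<close>.
\<close>

definition circ_modulus :: "'l::finite itself \<Rightarrow> bit poly" where
  "circ_modulus _ = monom 1 CARD('l) + 1"

definition circ_rel :: "'l::finite itself \<Rightarrow> bit poly \<Rightarrow> bit poly \<Rightarrow> bool" where
  "circ_rel L p q \<longleftrightarrow> circ_modulus L dvd (p - q)"

lemma equivp_circ_rel: "equivp (circ_rel L)"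
proof (rule equivpI)
  show "reflp (circ_rel L)" by (rule reflpI) (simp add: circ_rel_def)
  show "symp (circ_rel L)"
    by (rule sympI) (metis circ_rel_def dvd_minus_iff minus_diff_eq)
  show "transp (circ_rel L)"
  proof (rule transpI)
    fix p q r assume "circ_rel L p q" "circ_rel L q r"
    then have "circ_modulus L dvd (p - q) + (q - r)"
      unfolding circ_rel_def by (rule dvd_add)
    then show "circ_rel L p r" by (simp add: circ_rel_def)
  qed
qed

quotient_type 'l circ = "bit poly" / "circ_rel TYPE('l::finite)"
  by (rule equivp_circ_rel)

lemma degree_circ_modulus: "degree (circ_modulus TYPE('l::finite)) = CARD('l)"
  unfolding circ_modulus_def
  by (subst degree_add_eq_left) (simp_all add: degree_monom_eq)

instantiation circ :: (finite) comm_ring_1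
begin

lift_definition zero_circ :: "'a circ" is 0 .

lift_definition one_circ :: "'a circ" is 1 .

lift_definition plus_circ :: "'a circ \<Rightarrow> 'a circ \<Rightarrow> 'a circ" is "(+)"
  unfolding circ_rel_def by (metis add_diff_add dvd_add)

lift_definition uminus_circ :: "'a circ \<Rightarrow> 'a circ" is "uminus"
  unfolding circ_rel_def by (metis dvd_minus_iff minus_diff_minus)

lift_definition minus_circ :: "'a circ \<Rightarrow> 'a circ \<Rightarrow> 'a circ" is "(-)"
  unfolding circ_rel_def by (metis diff_diff_eq2 diff_add_eq dvd_diff diff_diff_add add.commute)

lift_definition times_circ :: "'a circ \<Rightarrow> 'a circ \<Rightarrow> 'a circ" is "(*)"
proof -
  fix p p' q q' :: "bit poly"
  assume "circ_rel TYPE('a) p p'" "circ_rel TYPE('a) q q'"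
  moreover have "p * q - p' * q' = p * (q - q') + (p - p') * q'" by (simp add: algebra_simps)
  ultimately show "circ_rel TYPE('a) (p * q) (p' * q')"
    unfolding circ_rel_def by (metis dvd_add dvd_mult dvd_mult2)
qed

instance
proof
  show "(0 :: 'a circ) \<noteq> 1"
  proof (transfer, rule notI)
    assume "circ_rel TYPE('a) 0 1"
    then have "circ_modulus TYPE('a) dvd 1" by (simp add: circ_rel_def)
    then have "degree (circ_modulus TYPE('a)) = 0"
      by (metis degree_1 dvd_imp_degree_le le_zero_eq one_neq_zero)
    then show False by (simp add: degree_circ_modulus)
  qed
qed (transfer; simp add: algebra_simps circ_rel_def)+

end

lift_definition circ_x :: "'l::finite circ" is "monom 1 1" .

text \<open>The coefficient of \<open>x ^ m\<close>, for m below l, in the reduced representative.\<close>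

lift_definition circ_coeff :: "'l::finite circ \<Rightarrow> nat \<Rightarrow> bit"
  is "\<lambda>p. coeff (p mod circ_modulus TYPE('l))"
  unfolding circ_rel_def by (metis mod_eq_dvd_iff)

text \<open>The involution sending \<open>f(x)\<close> to \<open>f(x\<inverse>)\<close>; in the quotient \<open>x\<inverse> = x ^ (l - 1)\<close>.\<close>

lift_definition circ_conj :: "'l::finite circ \<Rightarrow> 'l circ"
  is "\<lambda>p. pcompose p (monom 1 (CARD('l) - 1))"
proof -
  fix p q :: "bit poly"
  let ?n = "CARD('l)" and ?y = "monom (1::bit) CARD('l)"
  assume "circ_rel TYPE('l) p q"
  then obtain k where "p - q = circ_modulus TYPE('l) * k"
    unfolding circ_rel_def by (elim dvdE)
  then have "pcompose p (monom 1 (?n - 1)) - pcompose q (monom 1 (?n - 1))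
      = pcompose (circ_modulus TYPE('l)) (monom 1 (?n - 1)) * pcompose k (monom 1 (?n - 1))"
    by (metis pcompose_diff pcompose_mult)
  moreover have "circ_modulus TYPE('l) dvd pcompose (circ_modulus TYPE('l)) (monom 1 (?n - 1))"
  proof -
    have minus_one: "r - 1 = r + 1" for r :: "bit poly"
      by (rule poly_eqI) simp
    have "pcompose (monom 1 k) r = r ^ k" for k and r :: "bit poly"
      by (induction k) (simp_all add: monom_Suc pcompose_pCons monom_0 pcompose_const)
    then have "pcompose (monom 1 ?n) (monom 1 (?n - 1)) = monom (1::bit) (?n - 1) ^ ?n" .
    also have "\<dots> = ?y ^ (?n - 1)" by (simp add: monom_power mult.commute)
    finally have "pcompose (circ_modulus TYPE('l)) (monom 1 (?n - 1)) = ?y ^ (?n - 1) - 1"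
      by (simp only: circ_modulus_def pcompose_add pcompose_1 minus_one)
    moreover have "?y - 1 dvd ?y ^ (?n - 1) - 1"
      by (metis dvd_triv_left power_diff_1_eq)
    ultimately show ?thesis by (simp only: circ_modulus_def minus_one)
  qed
  ultimately show "circ_rel TYPE('l) (pcompose p (monom 1 (CARD('l) - 1)))
      (pcompose q (monom 1 (CARD('l) - 1)))"
    unfolding circ_rel_def by (metis dvd_mult2)
qed

definition adjoint_mat :: "'l::finite circ mat \<Rightarrow> 'l circ mat" where
  "adjoint_mat A = transpose_mat (map_mat circ_conj A)"


section \<open>CSS codes and their logical bases\<close>

text \<open>
  A binary vector indexed by qubits is represented by its support; addition is symmetric
  difference. In particular checks and logical operators are given by supports.
\<close>

record 'q css =
  qubits :: "'q set"
  xchecks :: "'q set set"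
  zchecks :: "'q set set"

definition xor_sum :: "('i \<Rightarrow> 'q set) \<Rightarrow> 'i set \<Rightarrow> 'q set" where
  "xor_sum F I = {q. odd (card {i \<in> I. q \<in> F i})}"

definition f2_span :: "'q set set \<Rightarrow> 'q set set" where
  "f2_span C = {xor_sum id D | D. D \<subseteq> C \<and> finite D}"

definition f2_orthogonal :: "'q set \<Rightarrow> 'q set set \<Rightarrow> 'q set set" where
  "f2_orthogonal Q C = {T. T \<subseteq> Q \<and> (\<forall>c\<in>C. even (card (T \<inter> c)))}"

text \<open>
  The family F indexed by I represents a basis over GF(2) of the quotient of K by the
  span of S.
\<close>

definition basis_modulo :: "'q set set \<Rightarrow> 'q set set \<Rightarrow> 'i set \<Rightarrow> ('i \<Rightarrow> 'q set) \<Rightarrow> bool" where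
  "basis_modulo K S I F \<longleftrightarrow>
     finite I \<and> F ` I \<subseteq> K \<and>
     (\<forall>J\<subseteq>I. xor_sum F J \<in> f2_span S \<longrightarrow> J = {}) \<and>
     (\<forall>T\<in>K. \<exists>J\<subseteq>I. sym_diff T (xor_sum F J) \<in> f2_span S)"

definition Z_logical_basis :: "'q css \<Rightarrow> 'i set \<Rightarrow> ('i \<Rightarrow> 'q set) \<Rightarrow> bool" where
  "Z_logical_basis C I F \<longleftrightarrow>
     basis_modulo (f2_orthogonal (qubits C) (xchecks C)) (zchecks C) I F"

definition X_logical_basis :: "'q css \<Rightarrow> 'i set \<Rightarrow> ('i \<Rightarrow> 'q set) \<Rightarrow> bool" where
  "X_logical_basis C I F \<longleftrightarrow>
     basis_modulo (f2_orthogonal (qubits C) (zchecks C)) (xchecks C) I F"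


section \<open>Pauli operators\<close>

text \<open>
  A state assigns an amplitude to each computational basis state, the latter being identified
  with the set of qubits in which it is 1.
\<close>

type_synonym 'q state = "'q set \<Rightarrow> complex"

definition state_space :: "'q set \<Rightarrow> 'q state set" where
  "state_space Q = {\<psi>. \<forall>s. \<not> s \<subseteq> Q \<longrightarrow> \<psi> s = 0}"

definition pauli_Z :: "'q \<Rightarrow> 'q state \<Rightarrow> 'q state" where
  "pauli_Z q \<psi> = (\<lambda>s. if q \<in> s then - \<psi> s else \<psi> s)"

definition pauli_X :: "'q \<Rightarrow> 'q state \<Rightarrow> 'q state" where
  "pauli_X q \<psi> = (\<lambda>s. \<psi> (sym_diff s {q}))"

text \<open>The order of the factors is immaterial, as they commute.\<close>

definition pauli_product :: "('q \<Rightarrow> 'q state \<Rightarrow> 'q state) \<Rightarrow> 'q set \<Rightarrow> 'q state \<Rightarrow> 'q state" where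
  "pauli_product P S = Finite_Set.fold (\<lambda>q U. P q \<circ> U) id S"

lemma comp_fun_commute_pauli_Z: "comp_fun_commute (\<lambda>q U. pauli_Z q \<circ> U)"
  by unfold_locales (auto simp: pauli_Z_def fun_eq_iff)

lemma comp_fun_commute_pauli_X: "comp_fun_commute (\<lambda>q U. pauli_X q \<circ> U)"
proof
  fix q r :: 'a
  have "sym_diff (sym_diff s {q}) {r} = sym_diff (sym_diff s {r}) {q}" for s by blast
  then show "(\<lambda>U. pauli_X r \<circ> U) \<circ> (\<lambda>U. pauli_X q \<circ> U) =
      (\<lambda>U. pauli_X q \<circ> U) \<circ> (\<lambda>U. pauli_X r \<circ> U)"
    by (simp add: pauli_X_def fun_eq_iff)
qed

definition commutator :: "('q state \<Rightarrow> 'q state) \<Rightarrow> ('q state \<Rightarrow> 'q state) \<Rightarrow> 'q state \<Rightarrow> 'q state" where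
  "commutator S T \<psi> = (\<lambda>s. S (T \<psi>) s - T (S \<psi>) s)"

definition kdelta :: "nat \<Rightarrow> nat \<Rightarrow> complex" where
  "kdelta i j = of_bool (i = j)"


section \<open>Lifted product codes\<close>

text \<open>
  Coordinates of the middle module: \<open>Inl (i, j)\<close> in the left block (rows: columns of A,
  columns: rows of B), \<open>Inr (i, j)\<close> in the right block (rows: rows of A, columns: columns of B).
  A qubit is a coordinate together with the exponent of x.
\<close>

type_synonym coord = "(nat \<times> nat) + (nat \<times> nat)"
type_synonym qubit = "coord \<times> nat"

abbreviation q_L :: "nat \<Rightarrow> nat \<Rightarrow> nat \<Rightarrow> qubit" where
  "q_L i j m \<equiv> (Inl (i, j), m)"

abbreviation q_R :: "nat \<Rightarrow> nat \<Rightarrow> nat \<Rightarrow> qubit" where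
  "q_R i j m \<equiv> (Inr (i, j), m)"

definition coords :: "'l::finite circ mat \<Rightarrow> 'l circ mat \<Rightarrow> coord set" where
  "coords A B = ({..<dim_col A} \<times> {..<dim_row B}) <+> ({..<dim_row A} \<times> {..<dim_col B})"

definition LP_qubits :: "'l::finite circ mat \<Rightarrow> 'l circ mat \<Rightarrow> qubit set" where
  "LP_qubits A B = coords A B \<times> {..<CARD('l)}"

definition kron :: "'l::finite circ mat \<Rightarrow> 'l circ mat \<Rightarrow> nat \<times> nat \<Rightarrow> nat \<times> nat \<Rightarrow> 'l circ" where
  "kron A B = (\<lambda>(a, b) (i, j). A $$ (a, i) * B $$ (b, j))"

definition boundary1 :: "'l::finite circ mat \<Rightarrow> 'l circ mat \<Rightarrow> nat \<times> nat \<Rightarrow> coord \<Rightarrow> 'l circ" where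
  "boundary1 A B r = case_sum (kron A (1\<^sub>m (dim_row B)) r) (kron (1\<^sub>m (dim_row A)) B r)"

definition boundary2 :: "'l::finite circ mat \<Rightarrow> 'l circ mat \<Rightarrow> coord \<Rightarrow> nat \<times> nat \<Rightarrow> 'l circ" where
  "boundary2 A B = case_sum (kron (1\<^sub>m (dim_col A)) B) (kron A (1\<^sub>m (dim_col B)))"

definition boundary2_adjoint ::
    "'l::finite circ mat \<Rightarrow> 'l circ mat \<Rightarrow> nat \<times> nat \<Rightarrow> coord \<Rightarrow> 'l circ" where
  "boundary2_adjoint A B r c = circ_conj (boundary2 A B c r)"

text \<open>
  Binarization replaces an entry f by the circulant matrix of multiplication by f with
  respect to the basis \<open>1, x, \<dots>, x ^ (l - 1)\<close>.
\<close>

definition binarize :: "('r \<Rightarrow> 'c \<Rightarrow> 'l::finite circ) \<Rightarrow> 'r \<times> nat \<Rightarrow> 'c \<times> nat \<Rightarrow> bit" where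
  "binarize M = (\<lambda>(r, s) (c, m). circ_coeff (M r c * circ_x ^ m) s)"

definition row_supports :: "'q set \<Rightarrow> ('r \<Rightarrow> 'q \<Rightarrow> bit) \<Rightarrow> 'r set \<Rightarrow> 'q set set" where
  "row_supports Q H I = (\<lambda>r. {q \<in> Q. H r q = 1}) ` I"

definition LP :: "'l::finite circ mat \<Rightarrow> 'l circ mat \<Rightarrow> qubit css" where
  "LP A B = \<lparr>
     qubits = LP_qubits A B,
     xchecks = row_supports (LP_qubits A B) (binarize (boundary1 A B))
       (({..<dim_row A} \<times> {..<dim_row B}) \<times> {..<CARD('l)}),
     zchecks = row_supports (LP_qubits A B) (binarize (boundary2_adjoint A B))
       (({..<dim_col A} \<times> {..<dim_col B}) \<times> {..<CARD('l)}) \<rparr>"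

text \<open>
  Elements of the middle module are functions on coordinates, whose values outside
  \<open>coords A B\<close> are irrelevant.
\<close>

definition bin_supp ::
    "'l::finite circ mat \<Rightarrow> 'l circ mat \<Rightarrow> (coord \<Rightarrow> 'l circ) \<Rightarrow> qubit set" where
  "bin_supp A B w = {(c, m). (c, m) \<in> LP_qubits A B \<and> circ_coeff (w c) m = 1}"

definition x_mult :: "nat \<Rightarrow> (coord \<Rightarrow> 'l::finite circ) \<Rightarrow> coord \<Rightarrow> 'l circ" where
  "x_mult t w = (\<lambda>c. circ_x ^ t * w c)"

definition shift :: "nat \<Rightarrow> nat \<Rightarrow> qubit \<Rightarrow> qubit" where
  "shift l t = (\<lambda>(c, m). (c, (m + t) mod l))"

definition left_tensor :: "'l::finite circ vec \<Rightarrow> 'l circ vec \<Rightarrow> coord \<Rightarrow> 'l circ" where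
  "left_tensor a b = case_sum (\<lambda>(i, j). a $ i * b $ j) (\<lambda>_. 0)"


section \<open>Canonical codes\<close>

definition r_A :: "'l::finite circ mat \<Rightarrow> nat" where
  "r_A A = dim_col A - dim_row A"

definition r_B :: "'l::finite circ mat \<Rightarrow> nat" where
  "r_B B = dim_row B - dim_col B"

definition u_A :: "'l::finite circ mat \<Rightarrow> 'l circ mat \<Rightarrow> nat \<Rightarrow> 'l circ vec" where
  "u_A A GA i = unit_vec (r_A A) i @\<^sub>v row GA i"

definition e_A :: "'l::finite circ mat \<Rightarrow> nat \<Rightarrow> 'l circ vec" where
  "e_A A i = unit_vec (r_A A) i @\<^sub>v 0\<^sub>v (dim_row A)"

definition e_B :: "'l::finite circ mat \<Rightarrow> nat \<Rightarrow> 'l circ vec" where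
  "e_B B j = unit_vec (r_B B) j @\<^sub>v 0\<^sub>v (dim_col B)"

definition v_B :: "'l::finite circ mat \<Rightarrow> 'l circ mat \<Rightarrow> nat \<Rightarrow> 'l circ vec" where
  "v_B B GB j = unit_vec (r_B B) j @\<^sub>v row GB j"

definition Z_supp ::
    "'l::finite circ mat \<Rightarrow> 'l circ mat \<Rightarrow> 'l circ mat \<Rightarrow> nat \<Rightarrow> nat \<Rightarrow> nat \<Rightarrow> qubit set" where
  "Z_supp A B GA i j m = bin_supp A B (x_mult m (left_tensor (u_A A GA i) (e_B B j)))"

definition X_supp ::
    "'l::finite circ mat \<Rightarrow> 'l circ mat \<Rightarrow> 'l circ mat \<Rightarrow> nat \<Rightarrow> nat \<Rightarrow> nat \<Rightarrow> qubit set" where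
  "X_supp A B GB i j m = bin_supp A B (x_mult m (left_tensor (e_A A i) (v_B B GB j)))"

definition Z_bar ::
    "'l::finite circ mat \<Rightarrow> 'l circ mat \<Rightarrow> 'l circ mat \<Rightarrow> nat \<Rightarrow> nat \<Rightarrow> nat \<Rightarrow> qubit state \<Rightarrow> qubit state" where
  "Z_bar A B GA i j m = pauli_product pauli_Z (Z_supp A B GA i j m)"

definition X_bar ::
    "'l::finite circ mat \<Rightarrow> 'l circ mat \<Rightarrow> 'l circ mat \<Rightarrow> nat \<Rightarrow> nat \<Rightarrow> nat \<Rightarrow> qubit state \<Rightarrow> qubit state" where
  "X_bar A B GB i j m = pauli_product pauli_X (X_supp A B GB i j m)"

text \<open>
  The required permutations of coordinates are assumed to have been carried out. The two
  families are the whole of a Z-type and of an X-type logical basis, so the code has no further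
  logical qubits.
\<close>

definition canonical_LP ::
    "'l::finite circ mat \<Rightarrow> 'l circ mat \<Rightarrow> 'l circ mat \<Rightarrow> 'l circ mat \<Rightarrow> bool" where
  "canonical_LP A B GA GB \<longleftrightarrow>
     dim_row A \<le> dim_col A \<and> dim_col B \<le> dim_row B \<and>
     GA \<in> carrier_mat (r_A A) (dim_row A) \<and> GB \<in> carrier_mat (r_B B) (dim_col B) \<and>
     Z_logical_basis (LP A B) ({..<r_A A} \<times> {..<r_B B} \<times> {..<CARD('l)})
       (\<lambda>(i, j, m). Z_supp A B GA i j m) \<and>
     X_logical_basis (LP A B) ({..<r_A A} \<times> {..<r_B B} \<times> {..<CARD('l)})
       (\<lambda>(i, j, m). X_supp A B GB i j m)"

end

theory Submission
  imports Defs
begin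

text \<open>
  The support of \<open>Z\<^bsub>i,j,m\<^esub>\<close> lies in column \<open>j\<close> of the left block and that of \<open>X\<^bsub>i,j,m\<^esub>\<close> in
  row \<open>i\<close>; the identity blocks of the generators make the single common fibre contribute
  \<open>x ^ m\<close> on both sides. For symmetric codes the duality is the transposition of the left block,
  which works because the two generator blocks then agree: the difference of their rows would give
  a vector which passes all X-checks and misses all X-type logical operators, without being a sum
  of Z-checks.
\<close>

section \<open>Coefficients of circulants\<close>

lemma circ_coeff_0 [simp]: "circ_coeff 0 m = 0"
  by transfer simp

lemma circ_coeff_1: "circ_coeff (1 :: 'l::finite circ) m = of_bool (m = 0)"
proof transfer
  fix m
  have "degree (1 :: bit poly) < degree (circ_modulus TYPE('l))"
    by (simp add: degree_circ_modulus)
  then have "1 mod circ_modulus TYPE('l) = 1"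
    by (rule mod_poly_less)
  then show "coeff (1 mod circ_modulus TYPE('l)) m = of_bool (m = 0)"
    by (simp add: coeff_1)
qed

lemma circ_coeff_x_mult:
  assumes "m < CARD('l::finite)"
  shows "circ_coeff (circ_x * f :: 'l circ) (Suc m mod CARD('l)) = circ_coeff f m"
  using assms
proof (transfer fixing: m)
  fix p :: "bit poly"
  let ?M = "circ_modulus TYPE('l)" and ?n = "CARD('l)"
  assume m: "m < ?n"
  define r where "r = p mod ?M"
  \<comment> \<open>\<open>s\<close> is the reduced representative of \<open>x * r\<close>:
    subtracting this multiple of the modulus removes the term of degree \<open>?n\<close> and
    carries its coefficient to the constant term.\<close>
  define s where "s = monom 1 1 * r - Polynomial.smult (coeff r (?n - 1)) ?M"
  have M0: "?M \<noteq> 0"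
    using degree_circ_modulus[where 'l = 'l] by auto
  have "degree r < ?n"
    unfolding r_def using degree_mod_less'[OF M0] degree_circ_modulus[where 'l = 'l]
    by (cases "p mod ?M = 0") auto
  then have r: "coeff r k = 0" if "k \<ge> ?n" for k
    using that by (simp add: coeff_eq_0)
  have s: "coeff s k = (if k = 0 then coeff r (?n - 1)
      else if k < ?n then coeff r (k - 1) else 0)" for k
    using r[of "k - 1"]
    by (auto simp: s_def circ_modulus_def coeff_monom_mult coeff_1)
  have "degree s < degree ?M"
    unfolding degree_circ_modulus by (rule degree_lessI) (auto simp: s)
  then have "s mod ?M = s"
    by (rule mod_poly_less)
  moreover have "(monom 1 1 * p) mod ?M = s mod ?M"
  proof -
    have "?M dvd monom 1 1 * r - s"
      by (simp add: s_def dvd_smult)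
    then have "(monom 1 1 * r) mod ?M = s mod ?M"
      by (simp only: mod_eq_dvd_iff)
    then show ?thesis
      by (simp only: r_def mod_mult_right_eq)
  qed
  ultimately have "(monom 1 1 * p) mod ?M = s"
    by simp
  moreover have "coeff s (Suc m mod ?n) = coeff r m"
  proof (cases "Suc m = ?n")
    case True
    then have "?n - 1 = m"
      by simp
    with True show ?thesis
      by (simp add: s)
  qed (use m in \<open>auto simp: s\<close>)
  ultimately show "coeff (monom 1 1 * p mod ?M) (Suc m mod ?n) = coeff (p mod ?M) m"
    by (simp add: r_def)
qed

lemma circ_coeff_x_power_mult:
  assumes "m < CARD('l::finite)"
  shows "circ_coeff (circ_x ^ t * f :: 'l circ) ((m + t) mod CARD('l)) = circ_coeff f m"
proof (induction t)
  case (Suc t)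
  show ?case
    using circ_coeff_x_mult[of "(m + t) mod CARD('l)" "circ_x ^ t * f"] Suc
    by (simp add: mod_Suc_eq mult.assoc)
qed (use assms in simp)

lemma circ_coeff_x_power:
  assumes "m < CARD('l::finite)" "k < CARD('l)"
  shows "circ_coeff (circ_x ^ m :: 'l circ) k = of_bool (k = m)"
proof -
  \<comment> \<open>The exponent that multiplication by \<open>x ^ m\<close> moves to
    \<open>k\<close>, namely \<open>k - m\<close> modulo \<open>l\<close>; adding
    \<open>CARD('l) - m\<close> avoids truncated subtraction.\<close>
  define k' where "k' = (k + (CARD('l) - m)) mod CARD('l)"
  have "(k' + m) mod CARD('l) = k"
    using assms by (simp add: k'_def mod_simps)
  then have "circ_coeff (circ_x ^ m :: 'l circ) k = of_bool (k' = 0)"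
    using circ_coeff_x_power_mult[of k' m "1 :: 'l circ"]
    by (simp add: k'_def circ_coeff_1)
  also have "k' = 0 \<longleftrightarrow> k = m"
  proof
    assume "k' = 0"
    then show "k = m"
      using \<open>(k' + m) mod CARD('l) = k\<close> assms by simp
  qed (use assms in \<open>simp add: k'_def\<close>)
  finally show ?thesis .
qed


text \<open>In characteristic 2 the modulus is \<open>x ^ l - 1\<close>, so \<open>x ^ l = 1\<close>
  in the quotient.\<close>

lemma circ_x_power_mod: "(circ_x :: 'l::finite circ) ^ (m mod CARD('l)) = circ_x ^ m"
proof -
  have power: "(circ_x :: 'l circ) ^ k = abs_circ (monom 1 k)" for k
    by (induction k)
      (simp_all add: one_circ_def circ_x_def times_circ.abs_eq mult_monom)
  have "monom 1 CARD('l) - 1 = circ_modulus TYPE('l)"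
    by (rule poly_eqI) (simp add: circ_modulus_def)
  then have "(circ_x :: 'l circ) ^ CARD('l) = 1"
    by (simp add: power one_circ_def circ.abs_eq_iff circ_rel_def)
  then have "(circ_x :: 'l circ) ^ (CARD('l) * (m div CARD('l)) + m mod CARD('l)) = circ_x ^ (m mod CARD('l))"
    by (simp only: power_add power_mult power_one mult_1_left)
  then show ?thesis
    by (simp only: mult_div_mod_eq)
qed

section \<open>Conjugation of circulants\<close>

lemma circ_conj_0 [simp]: "circ_conj 0 = 0"
  by transfer (simp add: circ_rel_def)

text \<open>Substituting \<open>x ^ (l - 1)\<close> twice produces the exponent
  \<open>(l - 1) * (l - 1)\<close>, which is 1 modulo \<open>l\<close>.\<close>

lemma circ_conj_conj [simp]: "circ_conj (circ_conj f) = (f :: 'l::finite circ)"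
proof transfer
  fix p :: "bit poly"
  let ?M = "circ_modulus TYPE('l)" and ?n = "CARD('l)"
  let ?y = "monom (1 :: bit) (?n - 1)"
  have compose_monom: "pcompose (monom 1 k) q = q ^ k" for k and q :: "bit poly"
    by (induction k) (simp_all add: monom_Suc pcompose_pCons monom_0 pcompose_const)
  have minus_one: "q - 1 = q + 1" for q :: "bit poly"
    by (rule poly_eqI) simp
  define z where "z = pcompose ?y ?y"
  have z: "z = monom 1 ((?n - 1) * (?n - 1))"
    by (simp add: z_def compose_monom monom_power)
  have "?M dvd z - monom 1 1"
  proof (cases "?n = 1")
    \<comment> \<open>For \<open>l = 1\<close> the decomposition \<open>l = d + 2\<close> used below
      does not exist; here \<open>z = 1\<close> and the modulus is \<open>x + 1\<close>.\<close>
    case True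
    then show ?thesis
      by (subst dvd_minus_iff[symmetric])
        (simp add: z circ_modulus_def flip: minus_one one_pCons)
  next
    case False
    then have "?n \<ge> 2"
      using zero_less_card_finite[where 'a = 'l] by linarith
    then obtain d where d: "?n = d + 2"
      by (metis add.commute le_Suc_ex)
    have "(?n - 1) * (?n - 1) = 1 + ?n * d"
      by (simp add: d algebra_simps)
    then have "z - monom 1 1 = monom 1 1 * (monom 1 ?n ^ d - 1)"
      by (simp add: z mult_monom monom_power algebra_simps)
    moreover have "monom 1 ?n - 1 dvd monom (1 :: bit) ?n ^ d - 1"
      by (metis dvd_triv_left power_diff_1_eq)
    ultimately show ?thesis
      by (simp add: circ_modulus_def minus_one)
  qed
  \<comment> \<open>Congruent arguments give congruent values: Horner's scheme builds the
    composition from sums and products only.\<close>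
  then have "?M dvd pcompose p z - pcompose p (monom 1 1)"
    unfolding mod_eq_dvd_iff[symmetric]
  proof (induction p)
    case (pCons a p)
    then show ?case
      unfolding pcompose_pCons by (intro mod_add_cong mod_mult_cong refl)
  qed simp
  moreover have "pcompose p (monom 1 1) = p"
    by (simp add: monom_altdef pcompose_idR)
  ultimately show "circ_rel TYPE('l) (pcompose (pcompose p ?y) ?y) p"
    by (simp add: circ_rel_def z_def pcompose_assoc)
qed

section \<open>Parities of intersections\<close>

text \<open>The part of \<open>S\<close> in both \<open>X\<close> and \<open>Y\<close> is counted
  twice and drops out modulo 2. This is additivity of the binary inner product.\<close>

lemma odd_card_Int_sym_diff:
  assumes "finite S"
  shows "odd (card (S \<inter> sym_diff X Y)) \<longleftrightarrow> odd (card (S \<inter> X)) \<noteq> odd (card (S \<inter> Y))"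
proof -
  have "card (S \<inter> sym_diff X Y) = card (S \<inter> (X - Y)) + card (S \<inter> (Y - X))"
    by (subst card_Un_disjoint[symmetric]) (use assms in \<open>auto intro!: arg_cong[where f = card]\<close>)
  moreover have "card (S \<inter> X) = card (S \<inter> (X - Y)) + card (S \<inter> (X \<inter> Y))"
    by (subst card_Un_disjoint[symmetric]) (use assms in \<open>auto intro!: arg_cong[where f = card]\<close>)
  moreover have "card (S \<inter> Y) = card (S \<inter> (Y - X)) + card (S \<inter> (X \<inter> Y))"
    by (subst card_Un_disjoint[symmetric]) (use assms in \<open>auto intro!: arg_cong[where f = card]\<close>)
  ultimately show ?thesis
    by presburger
qed

lemma xor_sum_empty [simp]: "xor_sum F {} = {}"
  by (simp add: xor_sum_def)

lemma xor_sum_insert: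
  assumes "finite I" "i \<notin> I"
  shows "xor_sum F (insert i I) = sym_diff (F i) (xor_sum F I)"
proof -
  have "{k \<in> insert i I. q \<in> F k} =
      (if q \<in> F i then insert i {k \<in> I. q \<in> F k} else {k \<in> I. q \<in> F k})" for q
    by auto
  then show ?thesis
    using assms by (auto simp: xor_sum_def)
qed

text \<open>Linearity over GF(2) of the inner product with \<open>S\<close>, extended to finite
  sums.\<close>

lemma odd_card_Int_xor_sum:
  assumes "finite S" "finite I"
  shows "odd (card (S \<inter> xor_sum F I)) \<longleftrightarrow> odd (card {i \<in> I. odd (card (S \<inter> F i))})"
  using assms(2)
proof (induction I rule: finite_induct)
  case (insert i I)
  have "{k \<in> insert i I. odd (card (S \<inter> F k))} =
      (if odd (card (S \<inter> F i)) then insert i {k \<in> I. odd (card (S \<inter> F k))}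
       else {k \<in> I. odd (card (S \<inter> F k))})"
    by auto
  then show ?case
    using insert by (simp add: xor_sum_insert odd_card_Int_sym_diff[OF assms(1)])
qed simp

lemma even_card_Int_f2_span:
  assumes "finite S" "\<And>c. c \<in> C \<Longrightarrow> even (card (S \<inter> c))" "T \<in> f2_span C"
  shows "even (card (S \<inter> T))"
proof -
  obtain D where D: "T = xor_sum id D" "D \<subseteq> C" "finite D"
    using assms(3) by (auto simp: f2_span_def)
  then have "{i \<in> D. odd (card (S \<inter> id i))} = {}"
    using assms(2) by auto
  with D show ?thesis
    using odd_card_Int_xor_sum[OF assms(1), of D id] by (metis card.empty even_zero)
qed

text \<open>Pairing with \<open>G k\<close> reads off the coefficient of \<open>F k\<close> in the
  expansion of \<open>T\<close> modulo the span of \<open>C\<close>, since \<open>G\<close> is dual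
  to \<open>F\<close> and blind to \<open>C\<close>. All these pairings vanish, so the expansion is
  empty.\<close>

lemma basis_modulo_dual_imp_f2_span:
  assumes basis: "basis_modulo K C I F" and T: "T \<in> K"
    and fin: "\<And>k. k \<in> I \<Longrightarrow> finite (G k)"
    and dual: "\<And>i k. i \<in> I \<Longrightarrow> k \<in> I \<Longrightarrow> odd (card (G k \<inter> F i)) \<longleftrightarrow> i = k"
    and orth: "\<And>k c. k \<in> I \<Longrightarrow> c \<in> C \<Longrightarrow> even (card (G k \<inter> c))"
    and T0: "\<And>k. k \<in> I \<Longrightarrow> even (card (G k \<inter> T))"
  shows "T \<in> f2_span C"
proof -
  obtain J where J: "J \<subseteq> I" "sym_diff T (xor_sum F J) \<in> f2_span C"
    using basis T unfolding basis_modulo_def by blast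
  have "finite J"
    by (rule finite_subset[OF J(1)]) (use basis in \<open>simp add: basis_modulo_def\<close>)
  have "J = {}"
  proof (rule ccontr)
    assume "J \<noteq> {}"
    then obtain k where k: "k \<in> J" "k \<in> I"
      using J(1) by blast
    have "{i \<in> J. odd (card (G k \<inter> F i))} = {k}"
      using dual k J(1) by blast
    then have "odd (card (G k \<inter> xor_sum F J))"
      using odd_card_Int_xor_sum[OF fin[OF k(2)] \<open>finite J\<close>, of F] by simp
    then have "odd (card (G k \<inter> sym_diff T (xor_sum F J)))"
      using odd_card_Int_sym_diff[OF fin[OF k(2)]] T0[OF k(2)] by blast
    then show False
      using even_card_Int_f2_span[OF fin[OF k(2)] orth[OF k(2)] J(2)] by blast
  qed
  then show ?thesis
    using J(2) by simp
qed

section \<open>Products of Pauli operators\<close>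

lemma pauli_product_Z:
  assumes "finite S"
  shows "pauli_product pauli_Z S \<psi> = (\<lambda>s. (- 1) ^ card (S \<inter> s) * \<psi> s)"
proof -
  interpret comp_fun_commute "\<lambda>q U. pauli_Z q \<circ> U"
    by (rule comp_fun_commute_pauli_Z)
  have insert: "pauli_product pauli_Z (insert q S) = pauli_Z q \<circ> pauli_product pauli_Z S"
    if "finite S" "q \<notin> S" for q :: 'a and S
    using that by (simp add: pauli_product_def fold_insert)
  show ?thesis
    using assms
  proof (induction S rule: finite_induct)
    case step: (insert q S)
    then show ?case
      unfolding insert[OF step.hyps] o_apply step.IH
      by (auto simp: pauli_Z_def fun_eq_iff Int_insert_left)
  qed (simp add: pauli_product_def)
qed

lemma pauli_product_X:
  assumes "finite S"
  shows "pauli_product pauli_X S \<psi> = (\<lambda>s. \<psi> (sym_diff s S))"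
proof -
  interpret comp_fun_commute "\<lambda>q U. pauli_X q \<circ> U"
    by (rule comp_fun_commute_pauli_X)
  have insert: "pauli_product pauli_X (insert q S) = pauli_X q \<circ> pauli_product pauli_X S"
    if "finite S" "q \<notin> S" for q :: 'a and S
    using that by (simp add: pauli_product_def fold_insert)
  show ?thesis
    using assms
  proof (induction S rule: finite_induct)
    case step: (insert q S)
    have "sym_diff (sym_diff s {q}) S = sym_diff s (insert q S)" for s
      using step.hyps by blast
    then show ?case
      unfolding insert[OF step.hyps] o_apply step.IH by (simp add: pauli_X_def fun_eq_iff)
  qed (simp add: pauli_product_def)
qed

text \<open>Exchanging the two products costs a sign for every common qubit, so the two orders agree
  or are opposite according to the parity of the overlap.\<close>

lemma commutator_pauli_product:
  assumes "finite S" "finite T"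
  shows "commutator (pauli_product pauli_Z S) (pauli_product pauli_X T) \<psi> =
    (\<lambda>s. 2 * pauli_product pauli_Z S (pauli_product pauli_X T \<psi>) s * of_bool (odd (card (S \<inter> T))))"
proof
  fix s
  have "(- 1 :: complex) ^ card (S \<inter> sym_diff s T) =
      (- 1) ^ card (S \<inter> s) * (if odd (card (S \<inter> T)) then - 1 else 1)"
    using odd_card_Int_sym_diff[OF assms(1), of s T] by (auto simp: uminus_power_if)
  then show "commutator (pauli_product pauli_Z S) (pauli_product pauli_X T) \<psi> s =
      2 * pauli_product pauli_Z S (pauli_product pauli_X T \<psi>) s * of_bool (odd (card (S \<inter> T)))"
    by (auto simp: commutator_def pauli_product_Z[OF assms(1)] pauli_product_X[OF assms(2)])
qed

section \<open>Supports along rows and columns of the left block\<close>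

text \<open>Both logical families live on one line of the left block: \<open>f\<close> traces the
  line and \<open>w\<close> places a circulant on each coordinate. In image form, permuting
  coordinates only changes \<open>f\<close>.\<close>

definition fibre_supp :: "(nat \<Rightarrow> coord) \<Rightarrow> nat \<Rightarrow> (nat \<Rightarrow> 'l::finite circ) \<Rightarrow> qubit set" where
  "fibre_supp f n w = map_prod f id ` {(a, k). a < n \<and> k < CARD('l) \<and> circ_coeff (w a) k = 1}"

lemma finite_fibre_supp [simp]: "finite (fibre_supp f n (w :: nat \<Rightarrow> 'l::finite circ))"
proof -
  have "{(a, k). a < n \<and> k < CARD('l) \<and> circ_coeff (w a) k = 1} \<subseteq> {..<n} \<times> {..<CARD('l)}"
    by auto
  then show ?thesis
    unfolding fibre_supp_def by (intro finite_imageI) (rule finite_subset, auto)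
qed

lemma mem_fibre_supp:
  "(c, k) \<in> fibre_supp f n (w :: nat \<Rightarrow> 'l::finite circ) \<longleftrightarrow>
    (\<exists>a<n. c = f a \<and> k < CARD('l) \<and> circ_coeff (w a) k = 1)"
  unfolding fibre_supp_def image_iff by (simp add: Bex_def) blast

text \<open>The unit vector \<open>e_B B j\<close> makes the tensor vanish off column
  \<open>j\<close>.\<close>

lemma Z_supp_eq_fibre_supp:
  fixes A B GA :: "'l::finite circ mat"
  assumes "dim_row A \<le> dim_col A" "dim_col B \<le> dim_row B"
    and "dim_col GA = dim_row A" and "j < r_B B"
  shows "Z_supp A B GA i j m =
    fibre_supp (\<lambda>a. Inl (a, j)) (dim_col A) (\<lambda>a. circ_x ^ m * u_A A GA i $ a)"
proof -
  have "e_B B j $ b = of_bool (b = j)" if "b < dim_row B" for b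
    using that assms by (auto simp: e_B_def r_B_def)
  then have "(c, k) \<in> Z_supp A B GA i j m \<longleftrightarrow>
      (c, k) \<in> fibre_supp (\<lambda>a. Inl (a, j)) (dim_col A) (\<lambda>a. circ_x ^ m * u_A A GA i $ a)" for c k
    using assms
    by (auto simp: Z_supp_def bin_supp_def x_mult_def left_tensor_def mem_fibre_supp LP_qubits_def
        coords_def r_B_def of_bool_def split: sum.splits if_splits)
  then show ?thesis
    by auto
qed

lemma X_supp_eq_fibre_supp:
  fixes A B GB :: "'l::finite circ mat"
  assumes "dim_row A \<le> dim_col A" "dim_col B \<le> dim_row B"
    and "dim_col GB = dim_col B" and "i < r_A A"
  shows "X_supp A B GB i j m =
    fibre_supp (\<lambda>b. Inl (i, b)) (dim_row B) (\<lambda>b. circ_x ^ m * v_B B GB j $ b)"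
proof -
  have "e_A A i $ a = of_bool (a = i)" if "a < dim_col A" for a
    using that assms by (auto simp: e_A_def r_A_def)
  then have "(c, k) \<in> X_supp A B GB i j m \<longleftrightarrow>
      (c, k) \<in> fibre_supp (\<lambda>b. Inl (i, b)) (dim_row B) (\<lambda>b. circ_x ^ m * v_B B GB j $ b)" for c k
    using assms
    by (auto simp: X_supp_def bin_supp_def x_mult_def left_tensor_def mem_fibre_supp LP_qubits_def
        coords_def r_A_def of_bool_def split: sum.splits if_splits)
  then show ?thesis
    by auto
qed

text \<open>Column \<open>j\<close> and row \<open>i'\<close> share only the fibre
  \<open>(i', j)\<close>. Both indices fall into the identity blocks, so the entries there are
  \<open>x ^ m\<close> or 0 and \<open>x ^ m'\<close> or 0, nonzero exactly for
  \<open>i = i'\<close> and \<open>j = j'\<close> respectively.\<close>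

lemma Z_supp_Int_X_supp:
  fixes A B GA GB :: "'l::finite circ mat"
  assumes dims: "dim_row A \<le> dim_col A" "dim_col B \<le> dim_row B"
      "dim_col GA = dim_row A" "dim_col GB = dim_col B"
    and "i < r_A A" "j < r_B B" "m < CARD('l)" "i' < r_A A" "j' < r_B B" "m' < CARD('l)"
  shows "Z_supp A B GA i j m \<inter> X_supp A B GB i' j' m' =
    (if i = i' \<and> j = j' \<and> m = m' then {q_L i j m} else {})"
proof -
  have u: "u_A A GA i $ i' = of_bool (i = i')"
    using assms by (auto simp: u_A_def)
  have v: "v_B B GB j' $ j = of_bool (j = j')"
    using assms by (auto simp: v_B_def)
  have "(c, k) \<in> Z_supp A B GA i j m \<inter> X_supp A B GB i' j' m' \<longleftrightarrow>
      i = i' \<and> j = j' \<and> m = m' \<and> c = Inl (i, j) \<and> k = m" for c k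
  proof -
    have "i' < dim_col A" "j < dim_row B"
      using assms(6,8) by (simp_all add: r_A_def r_B_def)
    then have "(c, k) \<in> Z_supp A B GA i j m \<inter> X_supp A B GB i' j' m' \<longleftrightarrow>
        c = Inl (i', j) \<and> k < CARD('l) \<and>
        circ_coeff (circ_x ^ m * u_A A GA i $ i') k = 1 \<and>
        circ_coeff (circ_x ^ m' * v_B B GB j' $ j) k = 1"
      unfolding Z_supp_eq_fibre_supp[OF dims(1-3) assms(6)]
        X_supp_eq_fibre_supp[OF dims(1,2,4) assms(8)] Int_iff mem_fibre_supp
      by blast
    also have "\<dots> \<longleftrightarrow> i = i' \<and> j = j' \<and> m = m' \<and> c = Inl (i, j) \<and> k = m"
      unfolding u v using assms(7,10)
      by (cases "i = i'"; cases "j = j'") (auto simp: circ_coeff_x_power)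
    finally show ?thesis .
  qed
  then show ?thesis
    by auto
qed

lemma shift_bin_supp:
  fixes A B :: "'l::finite circ mat"
  shows "shift CARD('l) t ` bin_supp A B w = bin_supp A B (x_mult t w)"
proof -
  have "(c, k) \<in> shift CARD('l) t ` bin_supp A B w \<longleftrightarrow> (c, k) \<in> bin_supp A B (x_mult t w)" for c k
  proof
    assume "(c, k) \<in> shift CARD('l) t ` bin_supp A B w"
    then show "(c, k) \<in> bin_supp A B (x_mult t w)"
      by (auto simp: shift_def bin_supp_def LP_qubits_def x_mult_def circ_coeff_x_power_mult)
  next
    assume k: "(c, k) \<in> bin_supp A B (x_mult t w)"
    \<comment> \<open>The preimage \<open>k - t\<close> modulo \<open>l\<close>; reducing
      \<open>t\<close> first keeps the subtraction from being truncated.\<close>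
    define m where "m = (k + (CARD('l) - t mod CARD('l))) mod CARD('l)"
    have "(m + t) mod CARD('l) = (k + (CARD('l) - t mod CARD('l)) + t mod CARD('l)) mod CARD('l)"
      by (simp add: m_def mod_simps)
    also have "k + (CARD('l) - t mod CARD('l)) + t mod CARD('l) = k + CARD('l)"
      using mod_less_divisor[OF zero_less_card_finite[where 'a = 'l], of t] by linarith
    also have "\<dots> mod CARD('l) = k"
      using k by (simp add: bin_supp_def LP_qubits_def)
    finally have m: "(m + t) mod CARD('l) = k" "m < CARD('l)"
      by (simp_all add: m_def)
    then have "(c, m) \<in> bin_supp A B w"
      using k circ_coeff_x_power_mult[OF m(2), of t "w c"]
      by (auto simp: bin_supp_def LP_qubits_def x_mult_def)
    moreover have "(c, k) = shift CARD('l) t (c, m)"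
      by (simp add: shift_def m)
    ultimately show "(c, k) \<in> shift CARD('l) t ` bin_supp A B w"
      by blast
  qed
  then show ?thesis
    by auto
qed

section \<open>Permutations of the left block\<close>

text \<open>Exponents out of range are fixed because a permutation of the qubits must be the
  identity elsewhere; the right block never moves.\<close>

definition permute_left :: "nat \<Rightarrow> (nat \<times> nat \<Rightarrow> nat \<times> nat) \<Rightarrow> qubit \<Rightarrow> qubit" where
  "permute_left l h = (\<lambda>(c, m). (if m < l then map_sum h id c else c, m))"

lemma permute_left_q_L: "m < l \<Longrightarrow> permute_left l h (q_L i j m) = (Inl (h (i, j)), m)"
  by (simp add: permute_left_def)

text \<open>Exponents are unchanged, so the range test has the same outcome at both stages. This
  yields inverses and, with \<open>f = g\<close>, involutions.\<close>

lemma permute_left_comp_id: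
  assumes "f \<circ> g = id"
  shows "permute_left l f \<circ> permute_left l g = id"
proof
  fix q
  show "(permute_left l f \<circ> permute_left l g) q = id q"
    by (cases q) (simp add: permute_left_def sum.map_comp assms sum.map_id)
qed

lemma permute_left_permutes:
  fixes A B :: "'l::finite circ mat"
  assumes "h permutes {..<dim_col A} \<times> {..<dim_row B}"
  shows "permute_left CARD('l) h permutes LP_qubits A B"
proof -
  have "bij (permute_left CARD('l) h)"
    by (rule o_bij[of "permute_left CARD('l) (inv_into UNIV h)"])
      (intro permute_left_comp_id permutes_inv_o[OF assms])+
  moreover have "permute_left CARD('l) h q = q" if "q \<notin> LP_qubits A B" for q
  proof (cases q)
    case (Pair c m)
    with that permutes_not_in[OF assms] show ?thesis
      by (cases c) (auto simp: permute_left_def LP_qubits_def coords_def)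
  qed
  ultimately show ?thesis
    by (auto simp: permutes_def bij_iff)
qed

lemma permute_left_fibre_supp:
  fixes w :: "nat \<Rightarrow> 'l::finite circ"
  assumes "\<And>a. a < n \<Longrightarrow> map_sum h id (f a) = g a"
  shows "permute_left CARD('l) h ` fibre_supp f n w = fibre_supp g n w"
  unfolding fibre_supp_def image_image
  by (rule image_cong) (auto simp: permute_left_def assms)

section \<open>Rows and columns orthogonal to the checks\<close>

text \<open>
  The parity of this number is the coefficient of \<open>x ^ s\<close> in \<open>\<Sum>a<n. h a * w a\<close>.
\<close>

definition overlap :: "nat \<Rightarrow> (nat \<Rightarrow> 'l::finite circ) \<Rightarrow> (nat \<Rightarrow> 'l circ) \<Rightarrow> nat \<Rightarrow> nat" where
  "overlap n w h s = card {(a, k). a < n \<and> k < CARD('l) \<and> circ_coeff (w a) k = 1 \<and>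
     circ_coeff (h a * circ_x ^ k) s = 1}"

lemma overlap_cong: "(\<And>a. a < n \<Longrightarrow> h a = h' a) \<Longrightarrow> overlap n w h s = overlap n w h' s"
  unfolding overlap_def by (intro arg_cong[where f = card]) auto

text \<open>The check \<open>(r, s)\<close> contains the qubit \<open>(f a, k)\<close> iff
  \<open>x ^ s\<close> occurs in \<open>M r (f a) * x ^ k\<close>; injectivity of \<open>f\<close>
  lets index pairs be counted instead of qubits.\<close>

lemma card_fibre_supp_Int_check:
  fixes A B :: "'l::finite circ mat" and M :: "'r \<Rightarrow> coord \<Rightarrow> 'l circ"
  assumes "\<And>a. a < n \<Longrightarrow> f a \<in> coords A B" "inj_on f {..<n}"
  shows "card (fibre_supp f n w \<inter> {q \<in> LP_qubits A B. binarize M (r, s) q = 1}) =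
    overlap n w (\<lambda>a. M r (f a)) s"
proof -
  let ?S = "{(a, k). a < n \<and> k < CARD('l) \<and> circ_coeff (w a) k = 1 \<and>
     circ_coeff (M r (f a) * circ_x ^ k) s = 1}"
  have "fibre_supp f n w \<inter> {q \<in> LP_qubits A B. binarize M (r, s) q = 1} = map_prod f id ` ?S"
    using assms(1) by (auto simp: fibre_supp_def binarize_def LP_qubits_def)
  moreover have "inj_on (map_prod f id) ?S"
    using assms(2) by (auto simp: inj_on_def)
  ultimately show ?thesis
    by (simp add: overlap_def card_image)
qed

text \<open>On the left block the X-checks are \<open>A \<otimes> I\<close>, so the check
  \<open>(p, q)\<close> meets column \<open>j\<close> only for \<open>q = j\<close>, and there
  through row \<open>p\<close> of \<open>A\<close>. The condition thus says that \<open>A\<close>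
  annihilates \<open>w\<close>.\<close>

lemma column_orthogonal_xchecks_iff:
  fixes w :: "nat \<Rightarrow> 'l::finite circ"
  assumes "j < dim_row B"
  shows "fibre_supp (\<lambda>a. Inl (a, j)) (dim_col A) w
      \<in> f2_orthogonal (qubits (LP A B)) (xchecks (LP A B)) \<longleftrightarrow>
    (\<forall>p<dim_row A. \<forall>s<CARD('l). even (overlap (dim_col A) w (\<lambda>a. A $$ (p, a)) s))"
proof -
  let ?F = "fibre_supp (\<lambda>a. Inl (a, j)) (dim_col A) w :: qubit set"
  have "?F \<subseteq> LP_qubits A B"
    using assms by (auto simp: fibre_supp_def LP_qubits_def coords_def)
  moreover have "card (?F \<inter> {c \<in> LP_qubits A B. binarize (boundary1 A B) ((p, q), s) c = 1}) =
      (if q = j then overlap (dim_col A) w (\<lambda>a. A $$ (p, a)) s else 0)"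
    if "p < dim_row A" "q < dim_row B" for p q s
    using that assms
    by (subst card_fibre_supp_Int_check)
      (auto simp: overlap_def boundary1_def boundary2_def boundary2_adjoint_def kron_def
        inj_on_def coords_def)
  ultimately show ?thesis
    using assms
    by (auto simp: f2_orthogonal_def LP_def row_supports_def)
qed

text \<open>On the left block the Z-checks are the adjoint of \<open>I \<otimes> B\<close>, so only
  those with \<open>p = i\<close> meet row \<open>i\<close>. The condition says that the adjoint of
  \<open>B\<close> annihilates \<open>w\<close>, whichever row \<open>w\<close> is placed
  on.\<close>

lemma row_orthogonal_zchecks_iff:
  fixes w :: "nat \<Rightarrow> 'l::finite circ"
  assumes "i < dim_col A"
  shows "fibre_supp (\<lambda>b. Inl (i, b)) (dim_row B) w
      \<in> f2_orthogonal (qubits (LP A B)) (zchecks (LP A B)) \<longleftrightarrow>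
    (\<forall>q<dim_col B. \<forall>s<CARD('l). even (overlap (dim_row B) w (\<lambda>b. circ_conj (B $$ (b, q))) s))"
proof -
  let ?F = "fibre_supp (\<lambda>b. Inl (i, b)) (dim_row B) w :: qubit set"
  have "?F \<subseteq> LP_qubits A B"
    using assms by (auto simp: fibre_supp_def LP_qubits_def coords_def)
  moreover have "card (?F \<inter> {c \<in> LP_qubits A B. binarize (boundary2_adjoint A B) ((p, q), s) c = 1}) =
      (if p = i then overlap (dim_row B) w (\<lambda>b. circ_conj (B $$ (b, q))) s else 0)"
    if "p < dim_col A" "q < dim_col B" for p q s
    using that assms
    by (subst card_fibre_supp_Int_check)
      (auto simp: overlap_def boundary1_def boundary2_def boundary2_adjoint_def kron_def
        inj_on_def coords_def)
  ultimately show ?thesis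
    using assms
    by (auto simp: f2_orthogonal_def LP_def row_supports_def)
qed

section \<open>Agreement of the two generator blocks in a symmetric code\<close>

lemma finite_LP_qubits: "finite (LP_qubits A B)"
  by (simp add: LP_qubits_def coords_def)

lemma f2_orthogonal_sym_diff:
  assumes "finite Q" "S \<in> f2_orthogonal Q C" "T \<in> f2_orthogonal Q C"
  shows "sym_diff S T \<in> f2_orthogonal Q C"
proof -
  have "even (card (sym_diff S T \<inter> c))" if "c \<in> C" for c
  proof -
    \<comment> \<open>The checks may be infinite, so the finite set \<open>Q \<inter> c\<close>
      replaces \<open>c\<close>.\<close>
    have Q: "U \<inter> c = (Q \<inter> c) \<inter> U" if "U \<subseteq> Q" for U
      using that by blast
    have "S \<subseteq> Q" "T \<subseteq> Q" "sym_diff S T \<subseteq> Q" "even (card (S \<inter> c))" "even (card (T \<inter> c))"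
      using assms(2,3) \<open>c \<in> C\<close> by (auto simp: f2_orthogonal_def)
    then show ?thesis
      using odd_card_Int_sym_diff[of "Q \<inter> c" S T] assms(1) by (metis Q finite_Int)
  qed
  then show ?thesis
    using assms(2,3) by (auto simp: f2_orthogonal_def)
qed

text \<open>
  Both \<open>u\<^sub>i\<close> and \<open>v\<^sub>i\<close> are in the kernel of \<open>A\<close>, so the difference \<open>T\<close> of the two supports
  passes all X-checks. It misses all X-type logicals, hence is a sum of Z-checks. But the Z-checks
  are orthogonal to \<open>v\<^sub>j\<close> placed along any row of the left block, and the row through a point
  of \<open>T\<close> meets \<open>T\<close> nowhere else.
\<close>

lemma canonical_Z_supp_eq:
  fixes A B GA GB :: "'l::finite circ mat"
  assumes canonical: "canonical_LP A B GA GB" and adj: "B = adjoint_mat A"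
    and i: "i < r_A A" and j: "j < r_B B" and m: "m < CARD('l)"
  shows "Z_supp A B GA i j m = Z_supp A B GB i j m"
proof -
  let ?I = "{..<r_A A} \<times> {..<r_B B} \<times> {..<CARD('l)}"
  let ?KX = "f2_orthogonal (qubits (LP A B)) (xchecks (LP A B))"
  let ?KZ = "f2_orthogonal (qubits (LP A B)) (zchecks (LP A B))"
  have dims: "dim_row A \<le> dim_col A" "dim_col B \<le> dim_row B"
      "dim_col GA = dim_row A" "dim_col GB = dim_col B"
    and Zb: "basis_modulo ?KX (zchecks (LP A B)) ?I (\<lambda>(i, j, m). Z_supp A B GA i j m)"
    and Xb: "basis_modulo ?KZ (xchecks (LP A B)) ?I (\<lambda>(i, j, m). X_supp A B GB i j m)"
    using canonical unfolding canonical_LP_def Z_logical_basis_def X_logical_basis_def by auto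
  have sym: "dim_row B = dim_col A" "dim_col B = dim_row A" "r_B B = r_A A"
    by (simp_all add: adj adjoint_mat_def r_A_def r_B_def)
  have dims': "dim_col GB = dim_row A"
    using dims sym by simp
  \<comment> \<open>Hence \<open>Z_supp\<close> formed with \<open>GB\<close> is the vector
    \<open>v\<close> of index \<open>i\<close> placed in column \<open>j\<close>, the candidate to
    compare with.\<close>
  have u: "u_A A GB = v_B B GB"
    by (simp add: fun_eq_iff u_A_def v_B_def sym)
  have ZK: "Z_supp A B GA i j m \<in> ?KX"
    using Zb i j m unfolding basis_modulo_def by force
  have XK: "X_supp A B GB i' j' m' \<in> ?KZ" if "i' < r_A A" "j' < r_B B" "m' < CARD('l)" for i' j' m'
    using Xb that unfolding basis_modulo_def by force
  have conj_B: "circ_conj (B $$ (b, q)) = A $$ (q, b)" if "b < dim_row B" "q < dim_col B" for b q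
    using that by (simp add: adj adjoint_mat_def)
  \<comment> \<open>The X-type logical \<open>(i, i, m)\<close> exists because
    \<open>r_B B = r_A A\<close>; its orthogonality to the Z-checks puts the \<open>i\<close>-th
    \<open>v\<close> into the kernel of the adjoint of \<open>B\<close>, which is
    \<open>A\<close>.\<close>
  have "even (overlap (dim_col A) (\<lambda>a. circ_x ^ m * u_A A GB i $ a) (\<lambda>a. A $$ (p, a)) s)"
    if "p < dim_row A" "s < CARD('l)" for p s
  proof -
    have "i < dim_col A"
      using i by (simp add: r_A_def)
    then have "even (overlap (dim_row B) (\<lambda>a. circ_x ^ m * v_B B GB i $ a)
        (\<lambda>b. circ_conj (B $$ (b, p))) s)"
      using XK[of i i m] that i m sym
      unfolding X_supp_eq_fibre_supp[OF dims(1,2,4) i] row_orthogonal_zchecks_iff[OF \<open>i < dim_col A\<close>]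
      by simp
    also have "overlap (dim_row B) (\<lambda>a. circ_x ^ m * v_B B GB i $ a) (\<lambda>b. circ_conj (B $$ (b, p))) s
        = overlap (dim_row B) (\<lambda>a. circ_x ^ m * v_B B GB i $ a) (\<lambda>b. A $$ (p, b)) s"
      using that sym by (intro overlap_cong conj_B) auto
    finally show ?thesis
      by (simp add: u sym)
  qed
  then have Z'K: "Z_supp A B GB i j m \<in> ?KX"
    using j unfolding Z_supp_eq_fibre_supp[OF dims(1,2) dims' j]
    by (simp add: column_orthogonal_xchecks_iff r_B_def)
  define T where "T = sym_diff (Z_supp A B GA i j m) (Z_supp A B GB i j m)"
  have TK: "T \<in> ?KX"
    unfolding T_def using ZK Z'K
    by (intro f2_orthogonal_sym_diff) (simp_all add: LP_def finite_LP_qubits)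
  note Int_X = Z_supp_Int_X_supp[OF dims]
  \<comment> \<open>Both supports have the same identity block and meet each X-type logical in the
    same set, which cancels in \<open>T\<close>.\<close>
  have T_X: "X_supp A B GB i' j' m' \<inter> T = {}"
    if "i' < r_A A" "j' < r_B B" "m' < CARD('l)" for i' j' m'
    using Int_X[OF i j m that] Z_supp_Int_X_supp[OF dims(1,2) dims' dims(4) i j m that]
    unfolding T_def by blast
  \<comment> \<open>The X-type logicals serve as the family dual to the Z-type basis.\<close>
  have T_span: "T \<in> f2_span (zchecks (LP A B))"
  proof (rule basis_modulo_dual_imp_f2_span[OF Zb TK, where G = "\<lambda>(i, j, m). X_supp A B GB i j m"])
    fix k k' assume k: "k \<in> ?I" "k' \<in> ?I"
    obtain i1 j1 m1 i2 j2 m2 where eq: "k = (i1, j1, m1)" "k' = (i2, j2, m2)"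
      by (metis prod_cases3)
    show "odd (card ((case k' of (i, j, m) \<Rightarrow> X_supp A B GB i j m) \<inter>
        (case k of (i, j, m) \<Rightarrow> Z_supp A B GA i j m))) \<longleftrightarrow> k = k'"
      using k Int_X[of i1 j1 m1 i2 j2 m2] by (auto simp: eq Int_commute)
  next
    fix k c assume "k \<in> ?I" "c \<in> zchecks (LP A B)"
    then show "even (card ((case k of (i, j, m) \<Rightarrow> X_supp A B GB i j m) \<inter> c))"
      using XK by (auto simp: f2_orthogonal_def)
  next
    fix k assume "k \<in> ?I"
    then show "finite (case k of (i, j, m) \<Rightarrow> X_supp A B GB i j m)"
      by (auto simp: X_supp_eq_fibre_supp[OF dims(1,2,4)])
  qed (auto simp: T_X)
  have "T = {}"
  proof (rule ccontr)
    assume "T \<noteq> {}"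
    then obtain q where q: "q \<in> T"
      by blast
    have col: "\<exists>a k. q = (Inl (a, j), k) \<and> a < dim_col A \<and> k < CARD('l)" if "q \<in> T" for q
      using that unfolding T_def Z_supp_eq_fibre_supp[OF dims(1,2,3) j]
        Z_supp_eq_fibre_supp[OF dims(1,2) dims' j]
      by (cases q) (auto simp: mem_fibre_supp)
    then obtain a k where ak: "q = (Inl (a, j), k)" "a < dim_col A" "k < CARD('l)"
      using q by blast
    \<comment> \<open>The row \<open>a\<close> may lie beyond \<open>r_A A\<close>, where
      \<open>S\<close> is no logical basis member. Orthogonality still transfers from row
      \<open>i\<close>, as its criterion does not depend on the row.\<close>
    define S where "S = fibre_supp (\<lambda>b. Inl (a, b)) (dim_row B) (\<lambda>b. circ_x ^ k * v_B B GB j $ b)"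
    have "i < dim_col A"
      using i by (simp add: r_A_def)
    then have "S \<in> ?KZ"
      using XK[OF i j ak(3)] ak(2) unfolding S_def X_supp_eq_fibre_supp[OF dims(1,2,4) i]
      by (simp add: row_orthogonal_zchecks_iff)
    then have "even (card (S \<inter> T))"
      by (intro even_card_Int_f2_span[OF _ _ T_span]) (simp_all add: S_def f2_orthogonal_def)
    moreover have "S \<inter> T = {q}"
    proof -
      have jB: "j < dim_row B"
        using j by (simp add: r_B_def)
      \<comment> \<open>The identity block leaves exactly \<open>x ^ k\<close> where
        \<open>S\<close> crosses column \<open>j\<close>, the only column that \<open>T\<close>
        occupies.\<close>
      have "v_B B GB j $ j = 1"
        using j jB by (simp add: v_B_def)
      then have S_j: "(Inl (a, j), k') \<in> S \<longleftrightarrow> k' = k" if "k' < CARD('l)" for k'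
        using that jB ak(3) by (auto simp: S_def mem_fibre_supp circ_coeff_x_power)
      have "p = q" if "p \<in> S" "p \<in> T" for p
      proof -
        obtain a' k' where p: "p = (Inl (a', j), k')" "k' < CARD('l)"
          using col[OF \<open>p \<in> T\<close>] by blast
        then have "a' = a"
          using \<open>p \<in> S\<close> by (auto simp: S_def mem_fibre_supp)
        then show ?thesis
          using S_j[OF p(2)] \<open>p \<in> S\<close> p(1) ak(1) by simp
      qed
      moreover have "q \<in> S"
        using S_j[OF ak(3)] ak(1) by simp
      ultimately show ?thesis
        using q by blast
    qed
    ultimately show False
      by simp
  qed
  then show ?thesis
    unfolding T_def by blast
qed

section \<open>Assembly of the four claims\<close>

lemma x_mult_x_mult:
  "x_mult t (x_mult m w) = x_mult ((m + t) mod CARD('l)) (w :: coord \<Rightarrow> 'l::finite circ)"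
  by (simp add: x_mult_def circ_x_power_mod power_add mult_ac fun_eq_iff)

text \<open>The plain product map may move points with just one coordinate in range, so it is cut
  off outside the rectangle.\<close>

lemma map_prod_on_Times_permutes:
  assumes "r permutes I" "s permutes J"
  shows "(\<lambda>q. if q \<in> I \<times> J then map_prod r s q else q) permutes I \<times> J"
proof (rule bij_imp_permutes)
  have "bij_betw (map_prod r s) (I \<times> J) (I \<times> J)"
    using assms by (intro bij_betw_map_prod permutes_imp_bij)
  then show "bij_betw (\<lambda>q. if q \<in> I \<times> J then map_prod r s q else q) (I \<times> J) (I \<times> J)"
    by (rule bij_betw_cong[THEN iffD1, rotated]) simp
qed auto

lemma swap_on_Times_permutes:
  "(\<lambda>q. if q \<in> I \<times> I then prod.swap q else q) permutes I \<times> I"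
proof (rule bij_imp_permutes)
  show "bij_betw (\<lambda>q. if q \<in> I \<times> I then prod.swap q else q) (I \<times> I) (I \<times> I)"
    by (rule bij_betwI[where g = prod.swap]) auto
qed auto

theorem mainTheorem4:
  fixes A B GA GB :: "'l::finite circ mat" and l mA nA mB nB rA rB :: nat
  assumes l: "l = CARD('l)" and rA: "rA = nA - mA" and rB: "rB = mB - nB"
    and A: "A \<in> carrier_mat mA nA" and B: "B \<in> carrier_mat mB nB"
    and canonical: "canonical_LP A B GA GB"
  shows "(\<forall>i<rA. \<forall>j<rB. \<forall>m<l. \<forall>i'<rA. \<forall>j'<rB. \<forall>m'<l.
         (Z_supp A B GA i j m \<inter> X_supp A B GB i' j' m' \<noteq> {} \<longleftrightarrow> i = i' \<and> j = j' \<and> m = m') \<and>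
         (i = i' \<and> j = j' \<and> m = m' \<longrightarrow>
           Z_supp A B GA i j m \<inter> X_supp A B GB i' j' m' = {q_L i j m}) \<and>
         (\<forall>\<psi>\<in>state_space (LP_qubits A B).
           commutator (Z_bar A B GA i j m) (X_bar A B GB i' j' m') \<psi> =
           (\<lambda>s. 2 * Z_bar A B GA i j m (X_bar A B GB i' j' m' \<psi>) s
                  * kdelta i i' * kdelta j j' * kdelta m m'))) \<and>
    (\<forall>t.
         (\<forall>w. bin_supp A B (x_mult t w) = shift l t ` bin_supp A B w) \<and>
         (\<forall>i<rA. \<forall>j<rB. \<forall>m<l.
           shift l t ` Z_supp A B GA i j m = Z_supp A B GA i j ((m + t) mod l) \<and>
           shift l t ` X_supp A B GB i j m = X_supp A B GB i j ((m + t) mod l))) \<and>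
    (\<forall>sC sR. sC permutes {..<rB} \<and> sR permutes {..<rA} \<longrightarrow>
         (\<exists>PC PR.
           PC permutes LP_qubits A B \<and> PR permutes LP_qubits A B \<and>
           (\<forall>i<nA. \<forall>j<mB. \<forall>m<l. PC (q_L i j m) = q_L i (sC j) m) \<and>
           (\<forall>i<nA. \<forall>j<mB. \<forall>m<l. PR (q_L i j m) = q_L (sR i) j m) \<and>
           (\<forall>i<rA. \<forall>j<rB. \<forall>m<l.
             Z_supp A B GA i (sC j) m = PC ` Z_supp A B GA i j m \<and>
             X_supp A B GB (sR i) j m = PR ` X_supp A B GB i j m))) \<and>
    (B = adjoint_mat A \<longrightarrow>
         (\<exists>\<tau>. \<tau> permutes LP_qubits A B \<and> \<tau> \<circ> \<tau> = id \<and>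
           (\<forall>i<rA. \<forall>j<rB. \<forall>m<l.
             X_supp A B GB i j m = \<tau> ` Z_supp A B GA j i m \<and>
             \<tau> ` Z_supp A B GA i j m = X_supp A B GB j i m)))"
proof -
  note l [simp]
  have dims: "dim_row A \<le> dim_col A" "dim_col B \<le> dim_row B"
      "dim_col GA = dim_row A" "dim_col GB = dim_col B"
    using canonical unfolding canonical_LP_def by auto
  have r: "r_A A = rA" "r_B B = rB" "dim_col A = nA" "dim_row B = mB" "dim_row A = mA" "dim_col B = nB"
    using A B rA rB by (auto simp: r_A_def r_B_def)
  note Z = Z_supp_eq_fibre_supp[OF dims(1-3), unfolded r]
  note X = X_supp_eq_fibre_supp[OF dims(1,2,4), unfolded r]
  have pairs: "(Z_supp A B GA i j m \<inter> X_supp A B GB i' j' m' \<noteq> {} \<longleftrightarrow> i = i' \<and> j = j' \<and> m = m') \<and>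
         (i = i' \<and> j = j' \<and> m = m' \<longrightarrow>
           Z_supp A B GA i j m \<inter> X_supp A B GB i' j' m' = {q_L i j m}) \<and>
         (\<forall>\<psi>\<in>state_space (LP_qubits A B).
           commutator (Z_bar A B GA i j m) (X_bar A B GB i' j' m') \<psi> =
           (\<lambda>s. 2 * Z_bar A B GA i j m (X_bar A B GB i' j' m' \<psi>) s
                  * kdelta i i' * kdelta j j' * kdelta m m'))"
    if "i < rA" "j < rB" "m < l" "i' < rA" "j' < rB" "m' < l" for i j m i' j' m'
  proof -
    have "Z_supp A B GA i j m \<inter> X_supp A B GB i' j' m' =
        (if i = i' \<and> j = j' \<and> m = m' then {q_L i j m} else {})"
      using that by (intro Z_supp_Int_X_supp dims) (auto simp: r)
    moreover have "finite (Z_supp A B GA i j m)" "finite (X_supp A B GB i' j' m')"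
      using that by (simp_all add: Z X)
    ultimately show ?thesis
      by (cases "i = i' \<and> j = j' \<and> m = m'")
        (simp_all add: Z_bar_def X_bar_def commutator_pauli_product kdelta_def)
  qed
  have shifts: "(\<forall>w. bin_supp A B (x_mult t w) = shift l t ` bin_supp A B w) \<and>
         (\<forall>i<rA. \<forall>j<rB. \<forall>m<l.
           shift l t ` Z_supp A B GA i j m = Z_supp A B GA i j ((m + t) mod l) \<and>
           shift l t ` X_supp A B GB i j m = X_supp A B GB i j ((m + t) mod l))" for t
    by (simp add: shift_bin_supp Z_supp_def X_supp_def x_mult_x_mult)
  have parallel: "\<exists>PC PR.
           PC permutes LP_qubits A B \<and> PR permutes LP_qubits A B \<and>
           (\<forall>i<nA. \<forall>j<mB. \<forall>m<l. PC (q_L i j m) = q_L i (sC j) m) \<and>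
           (\<forall>i<nA. \<forall>j<mB. \<forall>m<l. PR (q_L i j m) = q_L (sR i) j m) \<and>
           (\<forall>i<rA. \<forall>j<rB. \<forall>m<l.
             Z_supp A B GA i (sC j) m = PC ` Z_supp A B GA i j m \<and>
             X_supp A B GB (sR i) j m = PR ` X_supp A B GB i j m)"
    if sC: "sC permutes {..<rB}" and sR: "sR permutes {..<rA}" for sC sR
  proof -
    define h where "h = (\<lambda>r s q. if q \<in> {..<nA} \<times> {..<mB} then map_prod r s q else q)"
    have h: "permute_left l (h r s) permutes LP_qubits A B"
      if "r permutes {..<nA}" "s permutes {..<mB}" for r s
      using map_prod_on_Times_permutes[OF that] permute_left_permutes[of "h r s" A B]
      by (simp add: h_def r)
    \<comment> \<open>Permutations of logical indices become permutations of physical ones by fixing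
      the remaining rows and columns.\<close>
    have le: "{..<rB} \<subseteq> {..<mB}" "{..<rA} \<subseteq> {..<nA}"
      by (auto simp: rA rB)
    have sC': "sC j < rB" if "j < rB" for j
      using permutes_in_image[OF sC] that by auto
    have sR': "sR i < rA" if "i < rA" for i
      using permutes_in_image[OF sR] that by auto
    show ?thesis
    proof (intro exI conjI allI impI)
      show "permute_left l (h id sC) permutes LP_qubits A B"
        by (intro h permutes_id permutes_subset[OF sC] le)
      show "permute_left l (h sR id) permutes LP_qubits A B"
        by (intro h permutes_id permutes_subset[OF sR] le)
    next
      \<comment> \<open>The circulants along the column depend on \<open>i\<close> and
        \<open>m\<close> but not on \<open>j\<close>, so moving the column suffices; below, the same
        holds for rows.\<close>
      fix i j m assume "i < rA" "j < rB" "m < l"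
      with le show "Z_supp A B GA i (sC j) m = permute_left l (h id sC) ` Z_supp A B GA i j m"
        by (auto simp: Z sC' h_def intro!: permute_left_fibre_supp[symmetric])
    next
      fix i j m assume "i < rA" "j < rB" "m < l"
      with le show "X_supp A B GB (sR i) j m = permute_left l (h sR id) ` X_supp A B GB i j m"
        by (auto simp: X sR' h_def intro!: permute_left_fibre_supp[symmetric])
    qed (simp_all add: permute_left_q_L h_def)
  qed
  have duality: "\<exists>\<tau>. \<tau> permutes LP_qubits A B \<and> \<tau> \<circ> \<tau> = id \<and>
           (\<forall>i<rA. \<forall>j<rB. \<forall>m<l.
             X_supp A B GB i j m = \<tau> ` Z_supp A B GA j i m \<and>
             \<tau> ` Z_supp A B GA i j m = X_supp A B GB j i m)"
    if adj: "B = adjoint_mat A"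
  proof -
    have sym: "mB = nA" "nB = mA" "rB = rA"
      using r by (simp_all add: adj adjoint_mat_def r_A_def r_B_def)
    have dims': "dim_col GB = dim_row A"
      using dims(4) r sym by simp
    \<comment> \<open>Transposition of the left block, which is square since \<open>mB = nA\<close>;
      the right block stays fixed.\<close>
    define h where "h = (\<lambda>q. if q \<in> {..<nA} \<times> {..<nA} then prod.swap q else q)"
    define \<tau> where "\<tau> = permute_left l h"
    have perm: "\<tau> permutes LP_qubits A B"
      using swap_on_Times_permutes[of "{..<nA}"] permute_left_permutes[of h A B]
      by (simp add: \<tau>_def h_def r sym)
    have "h \<circ> h = id"
      by (auto simp: h_def fun_eq_iff)
    then have inv: "\<tau> \<circ> \<tau> = id"
      unfolding \<tau>_def by (rule permute_left_comp_id)
    have swap: "X_supp A B GB i j m = \<tau> ` Z_supp A B GA j i m" if "i < rA" "j < rA" "m < l" for i j m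
    proof -
      \<comment> \<open>Passing from \<open>GA\<close> to \<open>GB\<close> makes the entries along
        the column those along the row of the X-type logical.\<close>
      have "Z_supp A B GA j i m = Z_supp A B GB j i m"
        using that by (intro canonical_Z_supp_eq[OF canonical adj]) (auto simp: r sym)
      also have "\<dots> = fibre_supp (\<lambda>a. Inl (a, i)) nA (\<lambda>a. circ_x ^ m * u_A A GB j $ a)"
        using that Z_supp_eq_fibre_supp[OF dims(1,2) dims'] by (simp add: r sym)
      also have "u_A A GB j = v_B B GB j"
        by (simp add: u_A_def v_B_def r sym)
      finally show ?thesis
        using that rA by (auto simp: X \<tau>_def sym h_def intro!: permute_left_fibre_supp[symmetric])
    qed
    show ?thesis
      \<comment> \<open>The second equation is \<open>swap\<close> with \<open>i\<close> and
        \<open>j\<close> exchanged.\<close>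
      using perm inv swap by (intro exI[of _ \<tau>]) (simp add: sym)
  qed
  show ?thesis
    by (rule conjI, (intro allI impI, rule pairs; assumption),
        rule conjI, (rule allI, rule shifts),
        rule conjI, (intro allI impI, elim conjE, rule parallel; assumption),
        rule impI, rule duality)
qed

end
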